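(* Let $x=(\nu_1,\dots,\nu_8;\kappa_1,\kappa_2;f,g)$ and let $x'=(\nu'_1,\dots,\nu'_8;\kappa'_1,\kappa'_2;f',g')\in K^{12}$ be a tuple with $x'\sim x$, where $\sim$ is the equivalence of type $E_6^{(1)}$ given in the context. Then for each generator $w\in\{s_0,s_1,s_2,s_3,s_4,s_5,s_6,\pi_1,\pi_2\}$ of $\widetilde W(E_6^{(1)})$, the action of $w$ on $x'$ has the same form as its action on $x$ up to the equivalence; that is, writing $w(x)=R_w(x)$ with $R_w$ the explicit tuple of rational expressions defining $w$, $$\bigl(w(\nu'_1),\dots,w(\nu'_8);w(\kappa'_1),w(\kappa'_2);w(f'),w(g')\bigr)\sim R_w(\nu'_1,\dots,\nu'_8;\kappa'_1,\kappa'_2;f',g').$$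
   Context: Let $K=\mathbb{C}(\nu_1,\dots,\nu_8,\kappa_1,\kappa_2,f,g)$ be the field of rational functions in 12 independent variables, and put $q=\kappa_1^2\kappa_2^2/(\nu_1\nu_2\cdots\nu_8)\in K$ (i.e. $\kappa_1^2\kappa_2^2=q\,\nu_1\cdots\nu_8$). Action of the generators of the extended affine Weyl group $\widetilde W(E_6^{(1)})$: the following are $\mathbb{C}$-algebra automorphisms of $K$; variables not mentioned are fixed. - $s_0:\nu_7\leftrightarrow\nu_8$; $s_1:\nu_5\leftrightarrow\nu_6$; $s_3:\nu_1\leftrightarrow\nu_2$; $s_4:\nu_2\leftrightarrow\nu_3$; $s_5:\nu_3\leftrightarrow\nu_4$. - $s_2:\ \nu_1\to\frac{\kappa_2}{\nu_6},\ \nu_6\to\frac{\kappa_2}{\nu_1},\ \kappa_1\to\frac{\kappa_1\kappa_2}{\nu_1\nu_6},\ f\to f\,\frac{\kappa_2(\nu_1 g-1)}{(\nu_1\nu_6-\kappa_2)fg+\nu_1\kappa_2 g-\nu_1\nu_6}$. - $s_6:\ \nu_1\to\frac{\kappa_1}{\nu_7},\ \nu_7\to\frac{\kappa_1}{\nu_1},\ \kappa_2\to\frac{\kappa_1\kappa_2}{\nu_1\nu_7},\ g\to g\,\frac{\nu_7(\nu_1-f)}{\kappa_1-\nu_7 f+(\nu_1\nu_7-\kappa_1)fg}$. - $\pi_1:\ \nu_1\to\nu_2/\kappa_2,\ \nu_2\to\nu_1/\kappa_2,\ \nu_3\to1/\nu_6,\ \nu_4\to1/\nu_5,\ \nu_5\to1/\nu_4,\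 \nu_6\to1/\nu_3,\ \nu_7\to1/\nu_7,\ \nu_8\to1/\nu_8,\ \kappa_1\to\nu_1\nu_2/(\kappa_1\kappa_2),\ \kappa_2\to1/\kappa_2,\ f\to\frac{\nu_1\nu_2(1-fg)}{\kappa_2\{\nu_1\nu_2 g+f-(\nu_1+\nu_2)fg\}},\ g\to\kappa_2 g$ (and $q\to1/q$). - $\pi_2:\ \nu_i\to1/\nu_i\ (i=1,2,3,4),\ \nu_5\to1/\nu_8,\ \nu_6\to1/\nu_7,\ \nu_7\to1/\nu_6,\ \nu_8\to1/\nu_5,\ \kappa_1\to1/\kappa_2,\ \kappa_2\to1/\kappa_1,\ f\leftrightarrow g$ (and $q\to1/q$). For each generator $w$, $R_w$ denotes the 12-tuple of rational expressions listed above giving $(w(\nu_1),\dots,w(\nu_8);w(\kappa_1),w(\kappa_2);w(f),w(g))$ in terms of $x$; $R_w(x')$ is obtained by substituting the entries of $x'$ for the corresponding variables. Equivalence of type $E_6^{(1)}$: two tuples $y'$ and $y=(\nu_1,\dots,\nu_8;\kappa_1,\kappa_2;f,g)$ with entries in $K$ satisfy $y'\sim y$ iff there exist $a,b,c\in K\setminus\{0\}$ such that $$y'=(a\nu_1,a\nu_2,a\nu_3,a\nu_4,b\nu_5,b\nu_6,c\nu_7,c\nu_8;\ ac\,\kappa_1,\ ab\,\kappa_2;\ af,\ g/a)$$ (here $\nu_i,\kappa_i,f,g$ denote the entries of $y$, whatever elements of $K$ they are). *)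

theory Defs
  imports
    Complex_Main
    "HOL-Library.Poly_Mapping"
    "HOL-Computational_Algebra.Fraction_Field"
begin

section \<open>The field of rational functions in twelve variables\<close>

datatype var = N1 | N2 | N3 | N4 | N5 | N6 | N7 | N8 | K1 | K2 | F | G

text \<open>
  The monomials have to be linearly ordered for the polynomial ring below to be recognised as an
  integral domain. The order is auxiliary.
\<close>

fun var_index :: "var \<Rightarrow> nat" where
  "var_index N1 = 0" | "var_index N2 = 1" | "var_index N3 = 2" | "var_index N4 = 3"
| "var_index N5 = 4" | "var_index N6 = 5" | "var_index N7 = 6" | "var_index N8 = 7"
| "var_index K1 = 8" | "var_index K2 = 9" | "var_index F = 10" | "var_index G = 11"

lemma var_index_inject: "var_index u = var_index v \<Longrightarrow> u = v"
  by (cases u; cases v) simp_all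

instantiation var :: linorder
begin

definition less_eq_var :: "var \<Rightarrow> var \<Rightarrow> bool" where
  "u \<le> v \<longleftrightarrow> var_index u \<le> var_index v"

definition less_var :: "var \<Rightarrow> var \<Rightarrow> bool" where
  "u < v \<longleftrightarrow> var_index u < var_index v"

instance
  by standard (auto simp: less_eq_var_def less_var_def intro: var_index_inject)

end

lemma UNIV_var: "(UNIV :: var set) = {N1, N2, N3, N4, N5, N6, N7, N8, K1, K2, F, G}"
proof (rule UNIV_eq_I)
  show "v \<in> {N1, N2, N3, N4, N5, N6, N7, N8, K1, K2, F, G}" for v
    by (cases v) simp_all
qed

instance var :: finite
  by standard (simp add: UNIV_var)

type_synonym mpoly12 = "(var \<Rightarrow>\<^sub>0 nat) \<Rightarrow>\<^sub>0 complex"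
type_synonym ratfun = "mpoly12 fract"

definition const :: "complex \<Rightarrow> ratfun" where
  "const c = Fract (Poly_Mapping.single 0 c) 1"

definition X :: "var \<Rightarrow> ratfun" where
  "X v = Fract (Poly_Mapping.single (Poly_Mapping.single v 1) 1) 1"


section \<open>The generators and their action\<close>

text \<open>
  A 12-tuple \<open>(\<nu>\<^sub>1, \<dots>, \<nu>\<^sub>8; \<kappa>\<^sub>1, \<kappa>\<^sub>2; f, g)\<close> is a function \<open>y\<close> on \<^typ>\<open>var\<close>, with
  \<open>\<nu>\<^sub>i = y N\<^sub>i\<close>, \<open>\<kappa>\<^sub>i = y K\<^sub>i\<close>, \<open>f = y F\<close>, \<open>g = y G\<close>.
\<close>

datatype gen = S0 | S1 | S2 | S3 | S4 | S5 | S6 | Pi1 | Pi2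

fun R :: "gen \<Rightarrow> (var \<Rightarrow> 'a::field) \<Rightarrow> var \<Rightarrow> 'a" where
  "R S0 y = y(N7 := y N8, N8 := y N7)"
| "R S1 y = y(N5 := y N6, N6 := y N5)"
| "R S3 y = y(N1 := y N2, N2 := y N1)"
| "R S4 y = y(N2 := y N3, N3 := y N2)"
| "R S5 y = y(N3 := y N4, N4 := y N3)"
| "R S2 y = y(
     N1 := y K2 / y N6,
     N6 := y K2 / y N1,
     K1 := y K1 * y K2 / (y N1 * y N6),
     F := y F * (y K2 * (y N1 * y G - 1) /
       ((y N1 * y N6 - y K2) * y F * y G + y N1 * y K2 * y G - y N1 * y N6)))"
| "R S6 y = y(
     N1 := y K1 / y N7,
     N7 := y K1 / y N1,
     K2 := y K1 * y K2 / (y N1 * y N7),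
     G := y G * (y N7 * (y N1 - y F) /
       (y K1 - y N7 * y F + (y N1 * y N7 - y K1) * y F * y G)))"
| "R Pi1 y = y(
     N1 := y N2 / y K2,
     N2 := y N1 / y K2,
     N3 := 1 / y N6,
     N4 := 1 / y N5,
     N5 := 1 / y N4,
     N6 := 1 / y N3,
     N7 := 1 / y N7,
     N8 := 1 / y N8,
     K1 := y N1 * y N2 / (y K1 * y K2),
     K2 := 1 / y K2,
     F := y N1 * y N2 * (1 - y F * y G) /
       (y K2 * (y N1 * y N2 * y G + y F - (y N1 + y N2) * y F * y G)),
     G := y K2 * y G)"
| "R Pi2 y = y(
     N1 := 1 / y N1,
     N2 := 1 / y N2,
     N3 := 1 / y N3,
     N4 := 1 / y N4,
     N5 := 1 / y N8,
     N6 := 1 / y N7,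
     N7 := 1 / y N6,
     N8 := 1 / y N5,
     K1 := 1 / y K2,
     K2 := 1 / y K1,
     F := y G,
     G := y F)"

definition is_algebra_automorphism :: "(ratfun \<Rightarrow> ratfun) \<Rightarrow> bool" where
  "is_algebra_automorphism \<phi> \<longleftrightarrow>
     bij \<phi> \<and> (\<forall>a b. \<phi> (a + b) = \<phi> a + \<phi> b) \<and> (\<forall>a b. \<phi> (a * b) = \<phi> a * \<phi> b) \<and>
     (\<forall>c. \<phi> (const c) = const c)"

definition act :: "gen \<Rightarrow> ratfun \<Rightarrow> ratfun" where
  "act w = (THE \<phi>. is_algebra_automorphism \<phi> \<and> (\<forall>v. \<phi> (X v) = R w X v))"

definition equiv_E6 :: "(var \<Rightarrow> 'a::field) \<Rightarrow> (var \<Rightarrow> 'a) \<Rightarrow> bool" (infix "\<sim>E6" 50) where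
  "y' \<sim>E6 y \<longleftrightarrow> (\<exists>a b c. a \<noteq> 0 \<and> b \<noteq> 0 \<and> c \<noteq> 0 \<and>
     y' N1 = a * y N1 \<and> y' N2 = a * y N2 \<and> y' N3 = a * y N3 \<and> y' N4 = a * y N4 \<and>
     y' N5 = b * y N5 \<and> y' N6 = b * y N6 \<and> y' N7 = c * y N7 \<and> y' N8 = c * y N8 \<and>
     y' K1 = a * c * y K1 \<and> y' K2 = a * b * y K2 \<and> y' F = a * y F \<and> y' G = y G / a)"


section \<open>Existence and uniqueness of the automorphisms\<close>

text \<open>
  This justifies the definite description in the definition of \<^const>\<open>act\<close>. For existence, the
  substitution homomorphism from polynomials to \<^typ>\<open>ratfun\<close> is extended to the partial
  homomorphism \<open>loc\<close> on the fractions whose denominator has a nonzero image. As \<open>R w\<close> is an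
  involution, \<open>loc\<close> is a left inverse of the substitution, which is therefore injective.
\<close>

definition poly_emb :: "mpoly12 \<Rightarrow> ratfun" where
  "poly_emb p = Fract p 1"

definition monom_eval :: "(var \<Rightarrow> 'a::field) \<Rightarrow> (var \<Rightarrow>\<^sub>0 nat) \<Rightarrow> 'a" where
  "monom_eval \<rho> m = (\<Prod>v\<in>UNIV. \<rho> v ^ Poly_Mapping.lookup m v)"

definition poly_eval :: "(complex \<Rightarrow> 'a) \<Rightarrow> (var \<Rightarrow> 'a::field) \<Rightarrow> mpoly12 \<Rightarrow> 'a" where
  "poly_eval h \<rho> p =
     (\<Sum>m\<in>Poly_Mapping.keys p. h (Poly_Mapping.lookup p m) * monom_eval \<rho> m)"

locale const_hom =
  fixes h :: "complex \<Rightarrow> 'a::field"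
  assumes h_add: "h (c + d) = h c + h d"
    and h_mult: "h (c * d) = h c * h d"
    and h_1: "h 1 = 1"
begin

lemma h_0: "h 0 = 0"
  using h_add[of 0 0] by (metis add_0 add_cancel_right_left)

lemma poly_eval_superset:
  assumes "finite A" "Poly_Mapping.keys p \<subseteq> A"
  shows "poly_eval h \<rho> p = (\<Sum>m\<in>A. h (Poly_Mapping.lookup p m) * monom_eval \<rho> m)"
  unfolding poly_eval_def using assms
  by (intro sum.mono_neutral_left) (auto simp: in_keys_iff h_0)

lemma poly_eval_add: "poly_eval h \<rho> (p + q) = poly_eval h \<rho> p + poly_eval h \<rho> q"
proof -
  let ?A = "Poly_Mapping.keys p \<union> Poly_Mapping.keys q"
  have "poly_eval h \<rho> r = (\<Sum>m\<in>?A. h (Poly_Mapping.lookup r m) * monom_eval \<rho> m)"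
    if "Poly_Mapping.keys r \<subseteq> ?A" for r
    using that by (intro poly_eval_superset) auto
  then show ?thesis
    using Poly_Mapping.keys_add[of p q]
    by (simp add: lookup_add h_add distrib_right sum.distrib)
qed

lemma poly_eval_single: "poly_eval h \<rho> (Poly_Mapping.single m c) = h c * monom_eval \<rho> m"
  by (subst poly_eval_superset[of "{m}"]) (auto simp: h_0)

lemma monom_eval_add: "monom_eval \<rho> (m + n) = monom_eval \<rho> m * monom_eval \<rho> n"
  by (simp add: monom_eval_def lookup_add power_add prod.distrib)

lemma monom_eval_0: "monom_eval \<rho> 0 = 1"
  by (simp add: monom_eval_def)

lemma monom_eval_var: "monom_eval \<rho> (Poly_Mapping.single v 1) = \<rho> v"
proof -
  have "monom_eval \<rho> (Poly_Mapping.single v 1) = (\<Prod>u\<in>UNIV. if u = v then \<rho> u else 1)"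
    unfolding monom_eval_def by (intro prod.cong) (auto simp: lookup_single when_def)
  then show ?thesis by simp
qed

end

lemma mpoly_induct_add [case_names single add]:
  fixes p :: "'m \<Rightarrow>\<^sub>0 'c::comm_monoid_add"
  assumes single: "\<And>m c. P (Poly_Mapping.single m c)"
    and add: "\<And>p q. P p \<Longrightarrow> P q \<Longrightarrow> P (p + q)"
  shows "P p"
proof (induction p rule: update_induct)
  case const
  show ?case using single[of undefined 0] by simp
next
  case (update p a b)
  have "Poly_Mapping.update a b p = p + Poly_Mapping.single a b"
    using update(1)
    by (intro poly_mapping_eqI)
      (auto simp: lookup_update lookup_add lookup_single when_def in_keys_iff)
  then show ?case using update single add by metis
qed

context const_hom
begin

lemma poly_eval_mult: "poly_eval h \<rho> (p * q) = poly_eval h \<rho> p * poly_eval h \<rho> q"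
proof (induction p rule: mpoly_induct_add)
  case (single m c)
  show ?case
    by (induction q rule: mpoly_induct_add)
      (simp_all add: mult_single poly_eval_single h_mult monom_eval_add distrib_left poly_eval_add)
qed (simp add: distrib_right poly_eval_add)

lemma poly_eval_1: "poly_eval h \<rho> 1 = 1"
proof -
  have "poly_eval h \<rho> (Poly_Mapping.single 0 1) = 1"
    unfolding poly_eval_single by (simp add: h_1 monom_eval_0)
  then show ?thesis by simp
qed

lemma poly_eval_0: "poly_eval h \<rho> 0 = 0"
  by (simp add: poly_eval_def)

lemma poly_eval_uminus: "poly_eval h \<rho> (- p) = - poly_eval h \<rho> p"
  using poly_eval_add[of \<rho> p "- p"] by (simp add: poly_eval_0 eq_neg_iff_add_eq_0 add.commute)

end

lemma mpoly_induct [case_names const var add mult]: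
  fixes p :: mpoly12
  assumes const: "\<And>c. P (Poly_Mapping.single 0 c)"
    and var: "\<And>v. P (Poly_Mapping.single (Poly_Mapping.single v 1) 1)"
    and add: "\<And>p q. P p \<Longrightarrow> P q \<Longrightarrow> P (p + q)"
    and mult: "\<And>p q. P p \<Longrightarrow> P q \<Longrightarrow> P (p * q)"
  shows "P p"
proof (induction p rule: mpoly_induct_add)
  case (single m c)
  have monom_add: "P (Poly_Mapping.single (m + n) 1)"
    if "P (Poly_Mapping.single m 1)" "P (Poly_Mapping.single n 1)" for m n
    using mult[OF that] by (simp add: mult_single)
  have "P (Poly_Mapping.single m 1)"
  proof (induction m rule: mpoly_induct_add)
    case (single v k)
    show ?case
    proof (induction k)
      case 0
      show ?case using const[of 1] by simp
    next
      case (Suc k)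
      have "Poly_Mapping.single v (Suc k) = Poly_Mapping.single v k + Poly_Mapping.single v 1"
        by (simp flip: single_add)
      then show ?case using monom_add[OF Suc var[of v]] by (simp only:)
    qed
  qed (rule monom_add)
  from mult[OF const[of c] this] show ?case by (simp add: mult_single)
qed (rule add)

lemma const_0: "const 0 = 0" and const_1: "const 1 = 1"
  and const_add: "const (c + d) = const c + const d"
  and const_mult: "const (c * d) = const c * const d"
  by (simp_all add: const_def Zero_fract_def One_fract_def single_add mult_single)

lemma poly_emb_const: "poly_emb (Poly_Mapping.single 0 c) = const c"
  and poly_emb_var: "poly_emb (Poly_Mapping.single (Poly_Mapping.single v 1) 1) = X v"
  and poly_emb_add: "poly_emb (p + q) = poly_emb p + poly_emb q"
  and poly_emb_mult: "poly_emb (p * q) = poly_emb p * poly_emb q"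
  by (simp_all add: poly_emb_def const_def X_def)

definition (in const_hom) loc :: "(var \<Rightarrow> 'a) \<Rightarrow> ratfun \<Rightarrow> 'a \<Rightarrow> bool" where
  "loc \<rho> z w \<longleftrightarrow> (\<exists>a b. poly_eval h \<rho> b \<noteq> 0 \<and> z = Fract a b \<and>
     w = poly_eval h \<rho> a / poly_eval h \<rho> b)"

context const_hom
begin

lemmas poly_eval_simps =
  poly_eval_0 poly_eval_1 poly_eval_add poly_eval_mult poly_eval_uminus

lemma loc_unique: "loc \<rho> z w \<Longrightarrow> loc \<rho> z w' \<Longrightarrow> w = w'"
proof -
  assume "loc \<rho> z w" "loc \<rho> z w'"
  then obtain a b c d where
    ab: "poly_eval h \<rho> b \<noteq> 0" "z = Fract a b" "w = poly_eval h \<rho> a / poly_eval h \<rho> b" and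
    cd: "poly_eval h \<rho> d \<noteq> 0" "z = Fract c d" "w' = poly_eval h \<rho> c / poly_eval h \<rho> d"
    unfolding loc_def by blast
  have "b \<noteq> 0" "d \<noteq> 0" using ab cd poly_eval_0 by metis+
  then have "a * d = c * b" using ab cd by (simp add: eq_fract)
  then have "poly_eval h \<rho> a * poly_eval h \<rho> d = poly_eval h \<rho> c * poly_eval h \<rho> b"
    by (simp flip: poly_eval_mult)
  then show "w = w'" using ab cd by (simp add: frac_eq_eq)
qed

lemma loc_poly: "loc \<rho> (poly_emb p) (poly_eval h \<rho> p)"
  unfolding loc_def poly_emb_def by (rule exI[of _ p], rule exI[of _ 1]) (simp add: poly_eval_1)

lemma loc_const: "loc \<rho> (const c) (h c)"
  using loc_poly[of \<rho> "Poly_Mapping.single 0 c"]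
  by (simp add: poly_emb_def const_def poly_eval_single monom_eval_0)

lemma loc_X: "loc \<rho> (X v) (\<rho> v)"
  using loc_poly[of \<rho> "Poly_Mapping.single (Poly_Mapping.single v 1) 1"]
  by (simp add: poly_emb_def X_def poly_eval_single monom_eval_var[simplified] h_1)

lemma loc_0: "loc \<rho> 0 0" and loc_1: "loc \<rho> 1 1"
  using loc_const[of \<rho> 0] loc_const[of \<rho> 1] by (simp_all add: const_0 const_1 h_0 h_1)

lemma loc_add:
  assumes "loc \<rho> z w" "loc \<rho> z' w'"
  shows "loc \<rho> (z + z') (w + w')"
proof -
  obtain a b c d where
    ab: "poly_eval h \<rho> b \<noteq> 0" "z = Fract a b" "w = poly_eval h \<rho> a / poly_eval h \<rho> b" and
    cd: "poly_eval h \<rho> d \<noteq> 0" "z' = Fract c d" "w' = poly_eval h \<rho> c / poly_eval h \<rho> d"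
    using assms unfolding loc_def by blast
  have "b \<noteq> 0" "d \<noteq> 0" using ab cd poly_eval_0 by metis+
  then show ?thesis unfolding loc_def using ab cd
    by (intro exI[of _ "a * d + c * b"] exI[of _ "b * d"])
      (simp add: poly_eval_simps add_frac_eq)
qed

lemma loc_uminus: "loc \<rho> z w \<Longrightarrow> loc \<rho> (- z) (- w)"
  unfolding loc_def by (metis minus_divide_left minus_fract poly_eval_uminus)

lemma loc_diff: "loc \<rho> z w \<Longrightarrow> loc \<rho> z' w' \<Longrightarrow> loc \<rho> (z - z') (w - w')"
  using loc_add[OF _ loc_uminus] by fastforce

lemma loc_mult:
  assumes "loc \<rho> z w" "loc \<rho> z' w'"
  shows "loc \<rho> (z * z') (w * w')"
proof -
  obtain a b c d where
    ab: "poly_eval h \<rho> b \<noteq> 0" "z = Fract a b" "w = poly_eval h \<rho> a / poly_eval h \<rho> b" and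
    cd: "poly_eval h \<rho> d \<noteq> 0" "z' = Fract c d" "w' = poly_eval h \<rho> c / poly_eval h \<rho> d"
    using assms unfolding loc_def by blast
  then show ?thesis unfolding loc_def
    by (intro exI[of _ "a * c"] exI[of _ "b * d"]) (simp add: poly_eval_simps)
qed

lemma loc_divide:
  assumes "loc \<rho> z w" "loc \<rho> z' w'" "w' \<noteq> 0"
  shows "loc \<rho> (z / z') (w / w')"
proof -
  obtain a b c d where
    ab: "poly_eval h \<rho> b \<noteq> 0" "z = Fract a b" "w = poly_eval h \<rho> a / poly_eval h \<rho> b" and
    cd: "poly_eval h \<rho> d \<noteq> 0" "z' = Fract c d" "w' = poly_eval h \<rho> c / poly_eval h \<rho> d"
    using assms unfolding loc_def by blast
  then show ?thesis unfolding loc_def using assms(3)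
    by (intro exI[of _ "a * d"] exI[of _ "b * c"]) (simp add: poly_eval_simps)
qed

lemmas loc_intros = loc_X loc_1 loc_add loc_diff loc_mult loc_divide

lemma loc_nonzero: "loc \<rho> z w \<Longrightarrow> w \<noteq> 0 \<Longrightarrow> z \<noteq> 0"
  using loc_0 loc_unique by blast

end

interpretation spec: const_hom "id :: complex \<Rightarrow> complex"
  by standard simp_all

interpretation sub: const_hom const
  by standard (simp_all add: const_add const_mult const_1)

lemma algebra_hom_eqI:
  fixes \<phi> \<psi> :: "ratfun \<Rightarrow> ratfun"
  assumes add: "\<And>a b. \<phi> (a + b) = \<phi> a + \<phi> b" "\<And>a b. \<psi> (a + b) = \<psi> a + \<psi> b"
    and mult: "\<And>a b. \<phi> (a * b) = \<phi> a * \<phi> b" "\<And>a b. \<psi> (a * b) = \<psi> a * \<psi> b"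
    and const: "\<And>c. \<phi> (const c) = const c" "\<And>c. \<psi> (const c) = const c"
    and X: "\<And>v. \<phi> (X v) = \<psi> (X v)"
  shows "\<phi> = \<psi>"
proof
  have poly: "\<phi> (poly_emb p) = \<psi> (poly_emb p)" for p
  proof (induction p rule: mpoly_induct)
    case (const c)
    show ?case by (simp add: poly_emb_const assms(5,6))
  next
    case (var v)
    show ?case by (simp only: poly_emb_var X)
  qed (simp_all add: poly_emb_add poly_emb_mult add mult)
  fix z
  show "\<phi> z = \<psi> z"
  proof (cases z)
    case (Fract a b)
    have e: "z * poly_emb b = poly_emb a" and "poly_emb b * (1 / poly_emb b) = 1"
      using Fract by (simp_all add: poly_emb_def eq_fract One_fract_def)
    then have "\<phi> (poly_emb b) \<noteq> 0"
      using mult(1)[of "poly_emb b" "1 / poly_emb b"] const(1)[of 1] by (auto simp: const_1)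
    moreover have "\<phi> z * \<phi> (poly_emb b) = \<psi> z * \<phi> (poly_emb b)"
      using mult(1)[of z "poly_emb b"] mult(2)[of z "poly_emb b"] e poly by metis
    ultimately show ?thesis by simp
  qed
qed

lemma ex_automorphism:
  assumes "\<And>v. sub.loc \<rho> (\<rho> v) (X v)"
  shows "\<exists>\<phi>. is_algebra_automorphism \<phi> \<and> (\<forall>v. \<phi> (X v) = \<rho> v)"
proof -
  have left_inverse: "sub.loc \<rho> (poly_eval const \<rho> p) (poly_emb p)" for p
  proof (induction p rule: mpoly_induct)
    case (const c)
    show ?case using sub.loc_const[of \<rho> c]
      by (simp add: poly_emb_const sub.poly_eval_single sub.monom_eval_0)
  next
    case (var v)
    show ?case using assms[of v]
      by (simp only: poly_emb_var sub.poly_eval_single sub.monom_eval_var const_1 mult_1)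
  qed (simp_all add: poly_emb_add poly_emb_mult sub.poly_eval_add sub.poly_eval_mult
    sub.loc_add sub.loc_mult)
  have nz: "poly_eval const \<rho> p \<noteq> 0" if "p \<noteq> 0" for p
    using left_inverse[of p] sub.loc_nonzero that
    by (fastforce simp: poly_emb_def Zero_fract_def eq_fract)
  have ex: "\<exists>w. sub.loc \<rho> z w" for z
    by (cases z) (use nz in \<open>unfold sub.loc_def, blast\<close>)
  define \<phi> where "\<phi> z = (THE w. sub.loc \<rho> z w)" for z
  have loc_\<phi>: "sub.loc \<rho> z (\<phi> z)" for z
    unfolding \<phi>_def using ex sub.loc_unique by (metis (mono_tags, lifting) theI)
  have \<phi>_eq: "\<phi> z = w" if "sub.loc \<rho> z w" for z w
    using that loc_\<phi> sub.loc_unique by blast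
  have add: "\<phi> (a + b) = \<phi> a + \<phi> b" and mult: "\<phi> (a * b) = \<phi> a * \<phi> b" for a b
    by (intro \<phi>_eq sub.loc_add sub.loc_mult loc_\<phi>)+
  have const: "\<phi> (const c) = const c" for c
    by (intro \<phi>_eq sub.loc_const)
  have X: "\<phi> (X v) = \<rho> v" and \<rho>: "\<phi> (\<rho> v) = X v" for v
    by (intro \<phi>_eq sub.loc_X assms)+
  have "\<phi> \<circ> \<phi> = id"
    by (rule algebra_hom_eqI) (simp_all add: add mult const X \<rho>)
  then have "bij \<phi>" by (rule o_bij) fact
  with add mult const X show ?thesis unfolding is_algebra_automorphism_def by blast
qed

definition regular :: "gen \<Rightarrow> (var \<Rightarrow> 'a::field) \<Rightarrow> bool" where
  "regular w y \<longleftrightarrow> y N1 \<noteq> 0 \<and> y N2 \<noteq> 0 \<and> y N3 \<noteq> 0 \<and> y N4 \<noteq> 0 \<and> y N5 \<noteq> 0 \<and> y N6 \<noteq> 0 \<and>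
     y N7 \<noteq> 0 \<and> y N8 \<noteq> 0 \<and> y K1 \<noteq> 0 \<and> y K2 \<noteq> 0 \<and>
     (w = S2 \<longrightarrow> (y N1 * y N6 - y K2) * y F * y G + y N1 * y K2 * y G - y N1 * y N6 \<noteq> 0) \<and>
     (w = S6 \<longrightarrow> y K1 - y N7 * y F + (y N1 * y N7 - y K1) * y F * y G \<noteq> 0) \<and>
     (w = Pi1 \<longrightarrow> y N1 * y N2 * y G + y F - (y N1 + y N2) * y F * y G \<noteq> 0)"

lemma (in const_hom) loc_R:
  assumes "regular w \<rho>"
  shows "loc \<rho> (R w X v) (R w \<rho> v)"
  using assms unfolding regular_def
  by (cases w; cases v) (auto intro!: loc_intros)

context
  fixes y :: "var \<Rightarrow> 'a::field" and w :: gen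
  assumes reg: "regular w y"
    and nz: "y N1 * y G - 1 \<noteq> 0" "y N2 * y G - 1 \<noteq> 0" "y K2 * y G - y N6 \<noteq> 0"
      "y N1 - y F \<noteq> 0" "y K1 - y N7 * y F \<noteq> 0"
begin

lemma denom_S2:
  assumes "w = S2"
  defines "z \<equiv> R S2 y"
  shows "(z N1 * z N6 - z K2) * z F * z G + z N1 * z K2 * z G - z N1 * z N6 =
    y K2 * y K2 * (y N1 * y G - 1) * (y K2 * y G - y N6) /
      (y N6 * ((y N1 * y N6 - y K2) * y F * y G + y N1 * y K2 * y G - y N1 * y N6))"
  using reg assms(1) unfolding regular_def z_def
  by (simp add: divide_simps) (simp add: algebra_simps)

lemma denom_S6:
  assumes "w = S6"
  defines "z \<equiv> R S6 y"
  shows "z K1 - z N7 * z F + (z N1 * z N7 - z K1) * z F * z G =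
    y K1 * (y N1 - y F) * (y K1 - y N7 * y F) /
      (y N1 * (y K1 - y N7 * y F + (y N1 * y N7 - y K1) * y F * y G))"
  using reg assms(1) unfolding regular_def z_def
  by (simp add: divide_simps) (simp add: algebra_simps)

lemma denom_Pi1:
  assumes "w = Pi1"
  defines "z \<equiv> R Pi1 y"
  shows "z N1 * z N2 * z G + z F - (z N1 + z N2) * z F * z G =
    y N1 * y N2 * (y N1 * y G - 1) * (y N2 * y G - 1) /
      (y K2 * (y N1 * y N2 * y G + y F - (y N1 + y N2) * y F * y G))"
  using reg assms(1) unfolding regular_def z_def
  by (simp add: divide_simps) (simp add: algebra_simps)

lemma R_regular: "regular w (R w y)"
proof (cases w)
  case S2
  then show ?thesis using reg nz denom_S2[OF S2] by (simp add: regular_def)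
next
  case S6
  then show ?thesis using reg nz denom_S6[OF S6] by (simp add: regular_def)
next
  case Pi1
  then show ?thesis using reg nz denom_Pi1[OF Pi1] by (simp add: regular_def)
qed (use reg in \<open>simp_all add: regular_def\<close>)

lemma R_involution: "R w (R w y) v = y v"
proof (cases w)
  case S2
  have unfold: "R S2 z F = z F * (z K2 * (z N1 * z G - 1) /
      ((z N1 * z N6 - z K2) * z F * z G + z N1 * z K2 * z G - z N1 * z N6))"
    for z :: "var \<Rightarrow> 'a" by simp
  have "R S2 (R S2 y) F = y F"
    unfolding unfold[of "R S2 y"] denom_S2[OF S2] using reg nz S2
    by (simp add: regular_def divide_simps)
  moreover have "R S2 (R S2 y) v = y v" if "v \<noteq> F"
    using that reg S2 by (cases v) (simp_all add: regular_def)
  ultimately show ?thesis using S2 by blast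
next
  case S6
  have unfold: "R S6 z G = z G * (z N7 * (z N1 - z F) /
      (z K1 - z N7 * z F + (z N1 * z N7 - z K1) * z F * z G))"
    for z :: "var \<Rightarrow> 'a" by simp
  have "R S6 (R S6 y) G = y G"
    unfolding unfold[of "R S6 y"] denom_S6[OF S6] using reg nz S6
    by (simp add: regular_def divide_simps)
  moreover have "R S6 (R S6 y) v = y v" if "v \<noteq> G"
    using that reg S6 by (cases v) (simp_all add: regular_def)
  ultimately show ?thesis using S6 by blast
next
  case Pi1
  have unfold: "R Pi1 z F = z N1 * z N2 * (1 - z F * z G) /
      (z K2 * (z N1 * z N2 * z G + z F - (z N1 + z N2) * z F * z G))"
    for z :: "var \<Rightarrow> 'a" by simp
  have "R Pi1 (R Pi1 y) F = y F"
    unfolding unfold[of "R Pi1 y"] denom_Pi1[OF Pi1] using reg nz Pi1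
    by (simp add: regular_def divide_simps) (simp add: algebra_simps)
  moreover have "R Pi1 (R Pi1 y) v = y v" if "v \<noteq> F"
    using that reg Pi1 by (cases v) (simp_all add: regular_def)
  ultimately show ?thesis using Pi1 by blast
qed (use reg in \<open>cases v; simp add: regular_def\<close>)+

end

definition sample :: "var \<Rightarrow> complex" where
  "sample = (\<lambda>_. 2)(K1 := 3, K2 := 5, F := 7, G := 11)"

lemma regular_X: "regular w X"
  unfolding regular_def
  by (intro conjI impI; rule spec.loc_nonzero[of sample])
    ((rule spec.loc_intros)+, simp add: sample_def)+

lemma R_R_X: "regular w (R w X)" "R w (R w X) v = X v"
proof -
  have "X N1 * X G - 1 \<noteq> 0" "X N2 * X G - 1 \<noteq> 0" "X K2 * X G - X N6 \<noteq> 0"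
    "X N1 - X F \<noteq> 0" "X K1 - X N7 * X F \<noteq> 0"
    by (rule spec.loc_nonzero[of sample], (rule spec.loc_intros)+, simp add: sample_def)+
  then show "regular w (R w X)" "R w (R w X) v = X v"
    by (simp_all only: R_regular R_involution regular_X not_False_eq_True)
qed

theorem ex1_automorphism:
  "\<exists>!\<phi>. is_algebra_automorphism \<phi> \<and> (\<forall>v. \<phi> (X v) = R w X v)"
proof (rule ex_ex1I)
  show "\<exists>\<phi>. is_algebra_automorphism \<phi> \<and> (\<forall>v. \<phi> (X v) = R w X v)"
  proof (rule ex_automorphism)
    show "sub.loc (R w X) (R w X v) (X v)" for v
      using sub.loc_R[OF R_R_X(1)] by (simp only: R_R_X(2))
  qed
next
  fix \<phi> \<psi>
  assume "is_algebra_automorphism \<phi> \<and> (\<forall>v. \<phi> (X v) = R w X v)"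
    and "is_algebra_automorphism \<psi> \<and> (\<forall>v. \<psi> (X v) = R w X v)"
  then show "\<phi> = \<psi>"
    unfolding is_algebra_automorphism_def by (intro algebra_hom_eqI) auto
qed

lemma act: "is_algebra_automorphism (act w)" "act w (X v) = R w X v"
  using theI'[OF ex1_automorphism[of w]] unfolding act_def by blast+

end

theory Submission
  imports Defs
begin

text \<open>
  Both sides are rescalings of \<open>R w X\<close>. The map \<open>R w\<close> is weighted homogeneous, so it sends
  equivalent tuples to equivalent tuples. On the other hand \<open>act w\<close> is a field automorphism, so it
  turns the factors \<open>a, b, c\<close> relating \<open>x'\<close> to \<open>X\<close> into their images, which relate \<open>act w \<circ> x'\<close>
  to \<open>act w \<circ> X = R w X\<close>.
\<close>

lemma equiv_E6_sym:
  assumes "y' \<sim>E6 y"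
  shows "y \<sim>E6 y'"
proof -
  from assms obtain a b c where "a \<noteq> 0" "b \<noteq> 0" "c \<noteq> 0"
    "y' N1 = a * y N1" "y' N2 = a * y N2" "y' N3 = a * y N3" "y' N4 = a * y N4"
    "y' N5 = b * y N5" "y' N6 = b * y N6" "y' N7 = c * y N7" "y' N8 = c * y N8"
    "y' K1 = a * c * y K1" "y' K2 = a * b * y K2" "y' F = a * y F" "y' G = y G / a"
    unfolding equiv_E6_def by blast
  then show ?thesis
    unfolding equiv_E6_def
    by (intro exI[of _ "1 / a"] exI[of _ "1 / b"] exI[of _ "1 / c"]) simp
qed

lemma equiv_E6_trans:
  assumes "y'' \<sim>E6 y'" "y' \<sim>E6 y"
  shows "y'' \<sim>E6 y"
proof -
  from assms(1) obtain a b c where "a \<noteq> 0" "b \<noteq> 0" "c \<noteq> 0"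
    "y'' N1 = a * y' N1" "y'' N2 = a * y' N2" "y'' N3 = a * y' N3" "y'' N4 = a * y' N4"
    "y'' N5 = b * y' N5" "y'' N6 = b * y' N6" "y'' N7 = c * y' N7" "y'' N8 = c * y' N8"
    "y'' K1 = a * c * y' K1" "y'' K2 = a * b * y' K2" "y'' F = a * y' F" "y'' G = y' G / a"
    unfolding equiv_E6_def by blast
  moreover from assms(2) obtain r s t where "r \<noteq> 0" "s \<noteq> 0" "t \<noteq> 0"
    "y' N1 = r * y N1" "y' N2 = r * y N2" "y' N3 = r * y N3" "y' N4 = r * y N4"
    "y' N5 = s * y N5" "y' N6 = s * y N6" "y' N7 = t * y N7" "y' N8 = t * y N8"
    "y' K1 = r * t * y K1" "y' K2 = r * s * y K2" "y' F = r * y F" "y' G = y G / r"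
    unfolding equiv_E6_def by blast
  ultimately show ?thesis
    unfolding equiv_E6_def
    by (intro exI[of _ "a * r"] exI[of _ "b * s"] exI[of _ "c * t"]) (simp add: ac_simps)
qed

text \<open>
  No regularity is needed: a vanishing denominator vanishes after rescaling too, and then both
  quotients are \<open>0\<close>.
\<close>

lemma R_equiv_E6:
  assumes "y' \<sim>E6 y"
  shows "R w y' \<sim>E6 R w y"
proof -
  from assms obtain a b c where nz: "a \<noteq> 0" "b \<noteq> 0" "c \<noteq> 0" and
    eqs: "y' N1 = a * y N1" "y' N2 = a * y N2" "y' N3 = a * y N3" "y' N4 = a * y N4"
    "y' N5 = b * y N5" "y' N6 = b * y N6" "y' N7 = c * y N7" "y' N8 = c * y N8"
    "y' K1 = a * c * y K1" "y' K2 = a * b * y K2" "y' F = a * y F" "y' G = y G / a"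
    unfolding equiv_E6_def by blast
  show ?thesis
  proof (cases w)
    case S2
    \<comment> \<open>Since \<open>y F * y G\<close> is invariant and \<open>y N1 * y N6\<close> and
      \<open>y K2\<close> both scale by \<open>a * b\<close>, every term of the denominator does
      too. So does the numerator, and the quotient multiplying \<open>y F\<close> is
      unchanged.\<close>
    have "(y' N1 * y' N6 - y' K2) * y' F * y' G + y' N1 * y' K2 * y' G - y' N1 * y' N6 =
        a * b * ((y N1 * y N6 - y K2) * y F * y G + y N1 * y K2 * y G - y N1 * y N6)"
      using nz by (simp add: eqs algebra_simps)
    moreover have "y' K2 * (y' N1 * y' G - 1) = a * b * (y K2 * (y N1 * y G - 1))"
      using nz by (simp add: eqs)
    ultimately have "R w y' F = a * R w y F"
      using nz S2 by (simp add: eqs(11))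
    with S2 nz show ?thesis
      unfolding equiv_E6_def
      by (intro exI[of _ a] exI[of _ b] exI[of _ c]) (simp add: eqs)
  next
    case S6
    \<comment> \<open>The same weight count with \<open>N7\<close>, \<open>K1\<close> and
      \<open>c\<close> in place of \<open>N6\<close>, \<open>K2\<close> and \<open>b\<close>; now
      the factor of \<open>y G\<close> is invariant.\<close>
    have "y' K1 - y' N7 * y' F + (y' N1 * y' N7 - y' K1) * y' F * y' G =
        a * c * (y K1 - y N7 * y F + (y N1 * y N7 - y K1) * y F * y G)"
      using nz by (simp add: eqs algebra_simps)
    moreover have "y' N7 * (y' N1 - y' F) = a * c * (y N7 * (y N1 - y F))"
      by (simp add: eqs algebra_simps)
    ultimately have "R w y' G = R w y G / a"
      using nz S6 by (simp add: eqs(12))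
    with S6 nz show ?thesis
      unfolding equiv_E6_def
      by (intro exI[of _ a] exI[of _ b] exI[of _ c]) (simp add: eqs)
  next
    case Pi1
    have "y' K2 * (y' N1 * y' N2 * y' G + y' F - (y' N1 + y' N2) * y' F * y' G) =
        a * a * b * (y K2 * (y N1 * y N2 * y G + y F - (y N1 + y N2) * y F * y G))"
      using nz by (simp add: eqs algebra_simps)
    moreover have "y' N1 * y' N2 * (1 - y' F * y' G) = a * a * (y N1 * y N2 * (1 - y F * y G))"
      using nz by (simp add: eqs)
    ultimately have "R w y' F = 1 / b * R w y F"
      \<comment> \<open>The weights \<open>a * a\<close> over \<open>a * a * b\<close> leave
        \<open>1 / b\<close>, which is also the weight of \<open>y N2 / y K2\<close>.\<close>
      using nz Pi1 by simp
    with Pi1 nz show ?thesis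
      unfolding equiv_E6_def
      \<comment> \<open>The new \<open>N5\<close> is \<open>1 / y N4\<close>, so the second factor
        is \<open>1 / a\<close>; the new \<open>G\<close> is \<open>y K2 * y G\<close>, of weight
        \<open>b\<close>, the inverse of the first factor.\<close>
      by (intro exI[of _ "1 / b"] exI[of _ "1 / a"] exI[of _ "1 / c"]) (simp add: eqs)
  next
    case Pi2
    with nz show ?thesis
      unfolding equiv_E6_def
      \<comment> \<open>Inversion inverts the factors, and exchanging the pairs \<open>N5\<close>,
        \<open>N6\<close> and \<open>N7\<close>, \<open>N8\<close> swaps the roles of
        \<open>b\<close> and \<open>c\<close>.\<close>
      by (intro exI[of _ "1 / a"] exI[of _ "1 / c"] exI[of _ "1 / b"]) (simp add: eqs)
  \<comment> \<open>The remaining generators swap two entries that share a scaling factor, so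
    \<open>a\<close>, \<open>b\<close>, \<open>c\<close> still serve.\<close>
  qed (use nz in \<open>subst equiv_E6_def,
    intro exI[of _ a] exI[of _ b] exI[of _ c], simp add: eqs\<close>)+
qed

lemma equiv_E6_automorphism:
  assumes \<phi>: "is_algebra_automorphism \<phi>" and "y' \<sim>E6 y"
  shows "(\<lambda>v. \<phi> (y' v)) \<sim>E6 (\<lambda>v. \<phi> (y v))"
proof -
  have mult: "\<phi> (r * s) = \<phi> r * \<phi> s" for r s
    using \<phi> by (simp add: is_algebra_automorphism_def)
  \<comment> \<open>Zero is a constant, hence fixed; injectivity then keeps the images of the
    factors nonzero.\<close>
  have zero: "\<phi> 0 = 0"
    using \<phi> const_0 by (metis is_algebra_automorphism_def)
  have nonzero: "\<phi> r \<noteq> 0" if "r \<noteq> 0" for r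
    using \<phi> zero that by (metis bij_pointE is_algebra_automorphism_def)
  have divide: "\<phi> (r / s) = \<phi> r / \<phi> s" if "s \<noteq> 0" for r s
    using mult[of "r / s" s] nonzero[OF that] that by (simp add: eq_divide_eq)
  from assms(2) obtain a b c where "a \<noteq> 0" "b \<noteq> 0" "c \<noteq> 0"
    "y' N1 = a * y N1" "y' N2 = a * y N2" "y' N3 = a * y N3" "y' N4 = a * y N4"
    "y' N5 = b * y N5" "y' N6 = b * y N6" "y' N7 = c * y N7" "y' N8 = c * y N8"
    "y' K1 = a * c * y K1" "y' K2 = a * b * y K2" "y' F = a * y F" "y' G = y G / a"
    unfolding equiv_E6_def by blast
  then show ?thesis
    unfolding equiv_E6_def
    by (intro exI[of _ "\<phi> a"] exI[of _ "\<phi> b"] exI[of _ "\<phi> c"])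
      (simp add: nonzero mult divide)
qed

theorem theorem3p1:
  fixes x' :: "var \<Rightarrow> ratfun" and w :: gen
  assumes "x' \<sim>E6 X"
  shows "(\<lambda>v. act w (x' v)) \<sim>E6 R w x'"
proof (rule equiv_E6_trans)
  show "(\<lambda>v. act w (x' v)) \<sim>E6 R w X"
    using equiv_E6_automorphism[OF act(1) assms] by (simp add: act(2))
  show "R w X \<sim>E6 R w x'"
    by (rule equiv_E6_sym[OF R_equiv_E6[OF assms]])
qed

end
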